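(* Let $G=\prod_{k=1}^\infty\prod_{\ell=1}^k(\mathbb{Z}/2^{k-\ell+1}\mathbb{Z})^{\mathbb{N}}$ be equipped with the product filtration $G_\bullet$ which on each factor $\mathbb{Z}/2^{k-\ell+1}\mathbb{Z}$ indexed by $(k,\ell)$ has $i$-th term $2^{\max(i-\ell,0)}(\mathbb{Z}/2^{k-\ell+1}\mathbb{Z})$, $i\ge0$, and let $X$ be the compact group nilspace associated with $(G,G_\bullet)$. There exists no cube-surjective morphism $X\to\mathcal{H}$.
   Context: Given a compact abelian group $A$ with a filtration $A_\bullet$, i.e. closed subgroups $A=A_{(0)}=A_{(1)}\supseteq A_{(2)}\supseteq\cdots$, the associated group nilspace is the set $A$ equipped, for each $n\ge0$, with the set of $n$-cubes $C^n(A)$, the subgroup of $A^{\{0,1\}^n}$ generated by the maps $v\mapsto a\,v_{j_1}\cdots v_{j_s}$ with $s\ge0$, $j_1,\dots,j_s\in\{1,\dots,n\}$ distinct, $a\in A_{(s)}$. A morphism between two compact group nilspaces $X,Y$ is a continuous map $\varphi:X\to Y$ with $\varphi\circ c\in C^n(Y)$ for all $n$ and all $c\in C^n(X)$; it is cube-surjective if for every $n\ge0$ the map $C^n(X)\to C^n(Y)$, $c\mapsto\varphi\circ c$, is surjective. $\mathcal{H}$ is the group nilspace associated with the compact abelian group $\prod_{\ell=1}^\infty\mathbf{Z}^{\mathbb{N}}$ ($\mathbf{Z}$ the group of 2-adic integers) with filtration $\mathcal{H}_{(i)}=\prod_{\ell=1}^\infty\big(2^{\max(i-\ell,0)}\mathbf{Z}\big)^{\mathbb{N}}$,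 $i\ge0$. *)

theory Defs
  imports "HOL-Analysis.Analysis" "HOL-Algebra.Product_Groups" "HOL-Algebra.Generated_Groups"
begin

text \<open>Groups are written multiplicatively, as everywhere in \<open>HOL-Algebra\<close>; the group structure of
  \<open>Z/n\<close> is nevertheless addition modulo \<open>n\<close>, and \<open>x [^] n\<close> is the \<open>n\<close>-fold multiple of \<open>x\<close>.\<close>

record 'a filtered_top_group = "'a monoid" +
  topo :: "'a topology"
  filtr :: "nat \<Rightarrow> 'a set"

definition compact_abelian_group :: "('a, 'b) monoid_scheme \<Rightarrow> 'a topology \<Rightarrow> bool" where
  "compact_abelian_group A T \<longleftrightarrow>
     comm_group A \<and> topspace T = carrier A \<and> compact_space T \<and> Hausdorff_space T \<and>
     continuous_map (prod_topology T T) T (\<lambda>(x, y). x \<otimes>\<^bsub>A\<^esub> y) \<and>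
     continuous_map T T (m_inv A)"

definition compact_filtered_group :: "('a, 'b) filtered_top_group_scheme \<Rightarrow> bool" where
  "compact_filtered_group A \<longleftrightarrow>
     compact_abelian_group A (topo A) \<and>
     (\<forall>i. subgroup (filtr A i) A \<and> closedin (topo A) (filtr A i)) \<and>
     filtr A 0 = carrier A \<and> filtr A 1 = carrier A \<and> antimono (filtr A)"


subsection \<open>The associated group nilspace\<close>

definition cube_vertices :: "nat \<Rightarrow> (nat \<Rightarrow> nat) set" where
  "cube_vertices n = {1..n} \<rightarrow>\<^sub>E {0, 1}"

text \<open>Distinct indices \<open>j\<^sub>1, \<dots>, j\<^sub>s\<close> enter only through the set \<open>J\<close> of their values.\<close>

definition cube_generator ::
    "('a, 'b) monoid_scheme \<Rightarrow> nat \<Rightarrow> nat set \<Rightarrow> 'a \<Rightarrow> (nat \<Rightarrow> nat) \<Rightarrow> 'a" where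
  "cube_generator A n J a = (\<lambda>v\<in>cube_vertices n. a [^]\<^bsub>A\<^esub> (\<Prod>j\<in>J. v j))"

definition cubes :: "('a, 'b) filtered_top_group_scheme \<Rightarrow> nat \<Rightarrow> ((nat \<Rightarrow> nat) \<Rightarrow> 'a) set" where
  "cubes A n = generate (product_group (cube_vertices n) (\<lambda>_. A))
     {cube_generator A n J a | J a. J \<subseteq> {1..n} \<and> a \<in> filtr A (card J)}"

definition cube_comp :: "nat \<Rightarrow> ('a \<Rightarrow> 'b) \<Rightarrow> ((nat \<Rightarrow> nat) \<Rightarrow> 'a) \<Rightarrow> (nat \<Rightarrow> nat) \<Rightarrow> 'b" where
  "cube_comp n \<phi> c = (\<lambda>v\<in>cube_vertices n. \<phi> (c v))"

definition nilspace_morphism ::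
    "('a, 'c) filtered_top_group_scheme \<Rightarrow> ('b, 'd) filtered_top_group_scheme \<Rightarrow> ('a \<Rightarrow> 'b) \<Rightarrow> bool" where
  "nilspace_morphism X Y \<phi> \<longleftrightarrow>
     continuous_map (topo X) (topo Y) \<phi> \<and> (\<forall>n. \<forall>c\<in>cubes X n. cube_comp n \<phi> c \<in> cubes Y n)"

definition cube_surjective ::
    "('a, 'c) filtered_top_group_scheme \<Rightarrow> ('b, 'd) filtered_top_group_scheme \<Rightarrow> ('a \<Rightarrow> 'b) \<Rightarrow> bool" where
  "cube_surjective X Y \<phi> \<longleftrightarrow> (\<forall>n. \<forall>d\<in>cubes Y n. \<exists>c\<in>cubes X n. cube_comp n \<phi> c = d)"


subsection \<open>Products and power filtrations\<close>

definition product_filtered ::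
    "'i set \<Rightarrow> ('i \<Rightarrow> ('a, 'b) filtered_top_group_scheme) \<Rightarrow> ('i \<Rightarrow> 'a) filtered_top_group" where
  "product_filtered I A = monoid.extend (product_group I A)
     (filtered_top_group.fields (product_topology (\<lambda>i. topo (A i)) I)
        (\<lambda>n. \<Pi>\<^sub>E i\<in>I. filtr (A i) n))"

text \<open>The \<open>i\<close>-th term is \<open>2\<close> to the power \<open>max (i - l) 0\<close> times the group: subtraction on
  \<^typ>\<open>nat\<close> is truncated.\<close>

definition two_power_filtered :: "'a monoid \<Rightarrow> 'a topology \<Rightarrow> nat \<Rightarrow> 'a filtered_top_group" where
  "two_power_filtered A T l = monoid.extend A
     (filtered_top_group.fields T (\<lambda>i. (\<lambda>x. x [^]\<^bsub>A\<^esub> ((2::nat) ^ (i - l))) ` carrier A))"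

definition cyclic_filtered :: "nat \<Rightarrow> nat \<Rightarrow> int filtered_top_group" where
  "cyclic_filtered m l =
     two_power_filtered (integer_mod_group m) (discrete_topology (carrier (integer_mod_group m))) l"


subsection \<open>The 2-adic integers\<close>

text \<open>The inverse limit of the discrete groups \<open>Z/2\<^sup>n\<close>, realized as compatible sequences of
  residues with \<open>x n\<close> in \<open>{0..<2\<^sup>n}\<close>.\<close>

definition two_adic_group :: "(nat \<Rightarrow> int) monoid" where
  "two_adic_group = (product_group UNIV (\<lambda>n. integer_mod_group (2 ^ n)))
     \<lparr>carrier := {x \<in> (\<Pi>\<^sub>E n\<in>UNIV. carrier (integer_mod_group (2 ^ n))).
                   \<forall>n. x (Suc n) mod 2 ^ n = x n}\<rparr>"

definition two_adic_topology :: "(nat \<Rightarrow> int) topology" where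
  "two_adic_topology = subtopology
     (product_topology (\<lambda>n. discrete_topology (carrier (integer_mod_group (2 ^ n)))) UNIV)
     (carrier two_adic_group)"


subsection \<open>The nilspaces \<open>X\<close> and \<open>\<H>\<close>\<close>

text \<open>A factor raised to the power \<open>\<nat>\<close> contributes an extra index \<open>j :: nat\<close>.\<close>

definition X_nilspace :: "(nat \<times> nat \<times> nat \<Rightarrow> int) filtered_top_group" where
  "X_nilspace = product_filtered {(k, l, j). 1 \<le> l \<and> l \<le> k}
     (\<lambda>(k, l, j). cyclic_filtered (2 ^ (k - l + 1)) l)"

definition H_nilspace :: "(nat \<times> nat \<Rightarrow> nat \<Rightarrow> int) filtered_top_group" where
  "H_nilspace = product_filtered {(l, j). 1 \<le> l}
     (\<lambda>(l, j). two_power_filtered two_adic_group two_adic_topology l)"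


subsection \<open>Both are compact abelian groups with filtrations\<close>

lemma two_power_filtered_simps [simp]:
  "carrier (two_power_filtered A T l) = carrier A"
  "mult (two_power_filtered A T l) = mult A"
  "one (two_power_filtered A T l) = one A"
  "topo (two_power_filtered A T l) = T"
  "filtr (two_power_filtered A T l) = (\<lambda>i. (\<lambda>x. x [^]\<^bsub>A\<^esub> ((2::nat) ^ (i - l))) ` carrier A)"
  by (simp_all add: two_power_filtered_def monoid.defs filtered_top_group.defs)

lemma product_filtered_simps [simp]:
  "carrier (product_filtered I A) = (\<Pi>\<^sub>E i\<in>I. carrier (A i))"
  "mult (product_filtered I A) = (\<lambda>x y. \<lambda>i\<in>I. x i \<otimes>\<^bsub>A i\<^esub> y i)"
  "one (product_filtered I A) = (\<lambda>i\<in>I. \<one>\<^bsub>A i\<^esub>)"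
  "topo (product_filtered I A) = product_topology (\<lambda>i. topo (A i)) I"
  "filtr (product_filtered I A) = (\<lambda>n. \<Pi>\<^sub>E i\<in>I. filtr (A i) n)"
  by (simp_all add: product_filtered_def monoid.defs filtered_top_group.defs)

lemma compact_abelian_group_cong:
  assumes "carrier A = carrier B" "mult A = mult B" "one A = one B"
  shows "compact_abelian_group A T = compact_abelian_group B T"
proof -
  have "comm_group A = comm_group B"
    using assms unfolding comm_group_def comm_monoid_def comm_monoid_axioms_def
      group_def group_axioms_def monoid_def Units_def by simp
  moreover have "m_inv A = m_inv B"
    using assms by (simp add: m_inv_def fun_eq_iff)
  ultimately show ?thesis
    using assms by (simp add: compact_abelian_group_def)
qed

lemma subgroup_cong:
  assumes "carrier A = carrier B" "mult A = mult B" "one A = one B"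
  shows "subgroup S A = subgroup S B"
  using assms by (simp add: subgroup_def m_inv_def)

lemma continuous_map_nat_pow:
  assumes "compact_abelian_group A T"
  shows "continuous_map T T (\<lambda>x. x [^]\<^bsub>A\<^esub> (n::nat))"
proof (induction n)
  case 0
  interpret comm_group A using assms by (simp add: compact_abelian_group_def)
  show ?case using assms by (simp add: compact_abelian_group_def)
next
  case (Suc n)
  have "continuous_map T (prod_topology T T) (\<lambda>x. (x [^]\<^bsub>A\<^esub> n, x))"
    using Suc by (simp add: continuous_map_pairedI)
  then have "continuous_map T T ((\<lambda>(x, y). x \<otimes>\<^bsub>A\<^esub> y) \<circ> (\<lambda>x. (x [^]\<^bsub>A\<^esub> n, x)))"
    using assms continuous_map_compose unfolding compact_abelian_group_def by blast
  then show ?case by (simp add: o_def)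
qed

lemma compact_filtered_two_power:
  assumes A: "compact_abelian_group A T" and l: "1 \<le> l"
  shows "compact_filtered_group (two_power_filtered A T l)"
proof -
  interpret comm_group A using A by (simp add: compact_abelian_group_def)
  let ?p = "\<lambda>m::nat. (\<lambda>x. x [^]\<^bsub>A\<^esub> ((2::nat) ^ m))"
  have sub: "subgroup (?p m ` carrier A) A" for m
  proof (rule subgroup.intro)
    show "x \<otimes>\<^bsub>A\<^esub> y \<in> ?p m ` carrier A"
      if "x \<in> ?p m ` carrier A" "y \<in> ?p m ` carrier A" for x y
      using that by (auto simp: pow_mult_distrib[symmetric] m_comm)
    show "\<one>\<^bsub>A\<^esub> \<in> ?p m ` carrier A"
      by (rule image_eqI[of _ _ "\<one>\<^bsub>A\<^esub>"]) auto
    show "inv\<^bsub>A\<^esub> x \<in> ?p m ` carrier A" if "x \<in> ?p m ` carrier A" for x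
      using that by (auto simp: nat_pow_inv[symmetric])
  qed auto
  have cl: "closedin T (?p m ` carrier A)" for m
  proof -
    have "compactin T (?p m ` carrier A)"
      using A continuous_map_nat_pow[OF A] image_compactin
      unfolding compact_abelian_group_def compact_space_def by metis
    then show ?thesis
      using A by (simp add: compact_abelian_group_def compactin_imp_closedin)
  qed
  have "?p (j - l) ` carrier A \<subseteq> ?p (i - l) ` carrier A" if "i \<le> j" for i j
  proof
    fix y assume "y \<in> ?p (j - l) ` carrier A"
    then obtain x where x: "x \<in> carrier A" "y = ?p (j - l) x" by auto
    have "(2::nat) ^ (j - l) = 2 ^ ((j - l) - (i - l)) * 2 ^ (i - l)"
      using that by (simp flip: power_add)
    then have "y = ?p (i - l) (?p ((j - l) - (i - l)) x)"
      using x by (simp add: nat_pow_pow)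
    then show "y \<in> ?p (i - l) ` carrier A" using x by blast
  qed
  moreover have "?p 0 ` carrier A = carrier A" by simp
  ultimately show ?thesis
    using A l sub cl subgroup_cong[of "two_power_filtered A T l" A]
      compact_abelian_group_cong[of "two_power_filtered A T l" A T]
    by (simp add: compact_filtered_group_def monotone_def)
qed

lemma compact_abelian_product_group:
  assumes A: "\<And>i. i \<in> I \<Longrightarrow> compact_abelian_group (A i) (T i)"
  shows "compact_abelian_group (product_group I A) (product_topology T I)"
proof -
  have grp: "group (A i)" and cg: "comm_group (A i)" and ts: "topspace (T i) = carrier (A i)" if "i \<in> I" for i
    using A[OF that] by (auto simp: compact_abelian_group_def comm_group_def)
  interpret P: group "product_group I A" using grp by simp
  have "comm_group (product_group I A)"
    by (rule P.group_comm_groupI)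
       (auto simp: PiE_iff intro!: restrict_ext comm_monoid.m_comm comm_group.axioms(1) cg)
  moreover have top: "topspace (product_topology T I) = carrier (product_group I A)"
    using ts by (auto simp: PiE_iff)
  moreover have "compact_space (product_topology T I)" "Hausdorff_space (product_topology T I)"
    using A by (auto simp: compact_space_product_topology Hausdorff_space_product_topology
        compact_abelian_group_def)
  moreover have "continuous_map (prod_topology (product_topology T I) (product_topology T I))
      (product_topology T I) (\<lambda>(x, y). x \<otimes>\<^bsub>product_group I A\<^esub> y)"
    unfolding continuous_map_componentwise
  proof (intro conjI ballI)
    show "(\<lambda>(x, y). x \<otimes>\<^bsub>product_group I A\<^esub> y) `
        topspace (prod_topology (product_topology T I) (product_topology T I)) \<subseteq> extensional I"
      by auto
    fix i assume i: "i \<in> I"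
    let ?P = "prod_topology (product_topology T I) (product_topology T I)"
    have "continuous_map ?P (T i) ((\<lambda>x. x i) \<circ> fst)" "continuous_map ?P (T i) ((\<lambda>x. x i) \<circ> snd)"
      by (rule continuous_map_compose[OF _ continuous_map_product_projection[OF i]],
          simp add: continuous_map_fst continuous_map_snd)+
    then have "continuous_map ?P (prod_topology (T i) (T i)) (\<lambda>z. (fst z i, snd z i))"
      by (simp add: continuous_map_pairedI o_def)
    moreover have "continuous_map (prod_topology (T i) (T i)) (T i) (\<lambda>(x, y). x \<otimes>\<^bsub>A i\<^esub> y)"
      using A[OF i] by (simp add: compact_abelian_group_def)
    ultimately have "continuous_map ?P (T i) ((\<lambda>(x, y). x \<otimes>\<^bsub>A i\<^esub> y) \<circ> (\<lambda>z. (fst z i, snd z i)))"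
      by (rule continuous_map_compose)
    then show "continuous_map ?P (T i) (\<lambda>z. (case z of (x, y) \<Rightarrow> x \<otimes>\<^bsub>product_group I A\<^esub> y) i)"
      using i by (simp add: o_def case_prod_unfold)
  qed
  moreover have "continuous_map (product_topology T I) (product_topology T I) (\<lambda>x. \<lambda>i\<in>I. inv\<^bsub>A i\<^esub> x i)"
    unfolding continuous_map_componentwise
  proof (intro conjI ballI)
    fix i assume i: "i \<in> I"
    have "continuous_map (product_topology T I) (T i) (m_inv (A i) \<circ> (\<lambda>x. x i))"
      using A[OF i] i by (auto simp: compact_abelian_group_def
          intro!: continuous_map_compose continuous_map_product_projection)
    then show "continuous_map (product_topology T I) (T i) (\<lambda>x. (\<lambda>i\<in>I. inv\<^bsub>A i\<^esub> x i) i)"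
      using i by (simp add: o_def)
  qed auto
  then have "continuous_map (product_topology T I) (product_topology T I) (m_inv (product_group I A))"
    using top grp by (elim continuous_map_eq) (simp add: inv_product_group)
  ultimately show ?thesis
    by (simp add: compact_abelian_group_def)
qed

lemma compact_filtered_product:
  assumes A: "\<And>i. i \<in> I \<Longrightarrow> compact_filtered_group (A i)"
  shows "compact_filtered_group (product_filtered I A)"
proof -
  have c: "compact_abelian_group (product_group I A) (product_topology (\<lambda>i. topo (A i)) I)"
    using A by (auto simp: compact_filtered_group_def intro!: compact_abelian_product_group)
  have grp: "group (A i)" if "i \<in> I" for i
    using A[OF that] by (simp add: compact_filtered_group_def compact_abelian_group_def comm_group_def)
  have "subgroup (\<Pi>\<^sub>E i\<in>I. filtr (A i) n) (product_group I A)" for n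
    using A grp by (subst PiE_subgroup_product_group) (auto simp: compact_filtered_group_def)
  moreover have "closedin (product_topology (\<lambda>i. topo (A i)) I) (\<Pi>\<^sub>E i\<in>I. filtr (A i) n)" for n
    using A by (auto simp: closedin_product_topology compact_filtered_group_def)
  moreover have "antimono (\<lambda>n. \<Pi>\<^sub>E i\<in>I. filtr (A i) n)"
    using A unfolding compact_filtered_group_def antimono_def by (meson PiE_mono)
  ultimately show ?thesis
    using A c subgroup_cong[of "product_filtered I A" "product_group I A"]
      compact_abelian_group_cong[of "product_filtered I A" "product_group I A"]
    by (auto simp: compact_filtered_group_def cong: PiE_cong)
qed

lemma compact_abelian_integer_mod_group:
  assumes "m \<noteq> 0"
  shows "compact_abelian_group (integer_mod_group m) (discrete_topology (carrier (integer_mod_group m)))"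
proof -
  interpret comm_group "integer_mod_group m" by simp
  have "finite (carrier (integer_mod_group m))"
    using assms by (simp add: carrier_integer_mod_group)
  moreover have "x \<otimes>\<^bsub>integer_mod_group m\<^esub> y \<in> carrier (integer_mod_group m)"
    if "x \<in> carrier (integer_mod_group m)" "y \<in> carrier (integer_mod_group m)" for x y
    using that by (rule m_closed)
  ultimately show ?thesis
    unfolding compact_abelian_group_def
    by (auto simp: compact_space_discrete_topology prod_topology_discrete_topology[symmetric]
        comm_group_axioms simp del: mult_integer_mod_group)
qed

lemma compact_abelian_closed_subgroup:
  assumes A: "compact_abelian_group A T" and S: "subgroup S A" "closedin T S"
  shows "compact_abelian_group (A\<lparr>carrier := S\<rparr>) (subtopology T S)"
proof -
  interpret comm_group A using A by (simp add: compact_abelian_group_def)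
  have SA: "S \<subseteq> carrier A" using S by (simp add: subgroup.subset)
  have cg: "comm_group (A\<lparr>carrier := S\<rparr>)"
    by (rule group.group_comm_groupI[OF subgroup_imp_group[OF S(1)]]) (use SA m_comm in auto)
  have ts: "topspace (subtopology T S) = S"
    using A SA by (auto simp: compact_abelian_group_def)
  have m: "continuous_map (prod_topology (subtopology T S) (subtopology T S)) (subtopology T S)
      (\<lambda>(x, y). x \<otimes>\<^bsub>A\<^esub> y)"
    using A S unfolding compact_abelian_group_def subtopology_Times[symmetric]
    by (auto simp: continuous_map_in_subtopology subgroup.m_closed
        intro!: continuous_map_from_subtopology)
  have "continuous_map (subtopology T S) (subtopology T S) (m_inv A)"
    using A S unfolding compact_abelian_group_def
    by (auto simp: continuous_map_in_subtopology subgroup.m_inv_closed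
        intro!: continuous_map_from_subtopology)
  then have "continuous_map (subtopology T S) (subtopology T S) (m_inv (A\<lparr>carrier := S\<rparr>))"
    by (rule continuous_map_eq) (use S ts in \<open>simp add: m_inv_consistent\<close>)
  then show ?thesis
    using A S cg ts m unfolding compact_abelian_group_def
    by (auto simp: Hausdorff_space_subtopology closedin_compact_space compact_space_subtopology)
qed

lemma compact_abelian_two_adic: "compact_abelian_group two_adic_group two_adic_topology"
proof -
  let ?P = "product_group UNIV (\<lambda>n. integer_mod_group (2 ^ n))"
  let ?T = "product_topology (\<lambda>n. discrete_topology (carrier (integer_mod_group (2 ^ n)))) UNIV"
  let ?S = "carrier two_adic_group"
  have S: "?S = {x \<in> carrier ?P. \<forall>n. x (Suc n) mod 2 ^ n = x n}"
    by (simp add: two_adic_group_def)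
  have P: "compact_abelian_group ?P ?T"
    by (rule compact_abelian_product_group) (simp add: compact_abelian_integer_mod_group)
  interpret comm_group ?P using P by (simp add: compact_abelian_group_def)
  have dv: "(2::int) ^ n dvd 2 * 2 ^ n" for n by simp
  have "subgroup ?S ?P"
  proof (rule subgroupI)
    show "?S \<subseteq> carrier ?P" by (auto simp: S)
    have "\<one>\<^bsub>?P\<^esub> \<in> ?S" using one_closed by (simp add: S del: carrier_product_group)
    then show "?S \<noteq> {}" by blast
    fix x y assume x: "x \<in> ?S" and y: "y \<in> ?S"
    have xc: "x \<in> carrier ?P" and yc: "y \<in> carrier ?P" using x y by (auto simp: S)
    have "inv\<^bsub>?P\<^esub> x = (\<lambda>n. (- x n) mod 2 ^ n)"
      using xc by (subst inv_product_group) (auto simp: PiE_iff fun_eq_iff)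
    moreover have "(- x (Suc n)) mod (2 * 2 ^ n) mod 2 ^ n = (- x n) mod 2 ^ n" for n
      using x by (simp add: S mod_mod_cancel[OF dv]) (metis mod_minus_eq)
    ultimately show "inv\<^bsub>?P\<^esub> x \<in> ?S" using inv_closed[OF xc] by (simp add: S del: carrier_product_group)
    have "(x (Suc n) + y (Suc n)) mod (2 * 2 ^ n) mod 2 ^ n = (x n + y n) mod 2 ^ n" for n
      using x y by (simp add: S mod_mod_cancel[OF dv]) (metis mod_add_eq)
    then show "x \<otimes>\<^bsub>?P\<^esub> y \<in> ?S" using m_closed[OF xc yc] by (simp add: S del: carrier_product_group)
  qed
  moreover have "closedin ?T ?S"
  proof -
    have top: "topspace ?T = carrier ?P" by simp
    have "closedin ?T {x \<in> topspace ?T. (x (Suc n) mod 2 ^ n) = x n}" for n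
    proof (rule closedin_continuous_maps_eq[where Y = "discrete_topology (UNIV::int set)"])
      show "continuous_map ?T (discrete_topology UNIV) (\<lambda>x. x n)"
        using continuous_map_product_projection[of n UNIV "\<lambda>n. discrete_topology (carrier (integer_mod_group (2 ^ n)))"]
          continuous_map_compose[of ?T _ "\<lambda>x. x n" "discrete_topology UNIV" id]
        by (fastforce simp: o_def)
      show "continuous_map ?T (discrete_topology UNIV) (\<lambda>x. x (Suc n) mod 2 ^ n)"
        using continuous_map_product_projection[of "Suc n" UNIV "\<lambda>n. discrete_topology (carrier (integer_mod_group (2 ^ n)))"]
          continuous_map_compose[of ?T _ "\<lambda>x. x (Suc n)" "discrete_topology UNIV" "\<lambda>z. z mod 2 ^ n"]
        by (fastforce simp: o_def)
    qed auto
    then have "closedin ?T (\<Inter>n. {x \<in> topspace ?T. (x (Suc n) mod 2 ^ n) = x n})"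
      by (intro closedin_Inter) auto
    moreover have "(\<Inter>n. {x \<in> topspace ?T. (x (Suc n) mod 2 ^ n) = x n}) = ?S"
      unfolding top S by auto
    ultimately show ?thesis by simp
  qed
  ultimately have "compact_abelian_group (?P\<lparr>carrier := ?S\<rparr>) (subtopology ?T ?S)"
    by (rule compact_abelian_closed_subgroup[OF P])
  moreover have "?P\<lparr>carrier := ?S\<rparr> = two_adic_group"
    by (simp add: two_adic_group_def)
  ultimately show ?thesis
    by (simp add: two_adic_topology_def)
qed

lemma compact_filtered_X: "compact_filtered_group X_nilspace"
  unfolding X_nilspace_def cyclic_filtered_def
  by (auto intro!: compact_filtered_product compact_filtered_two_power
      compact_abelian_integer_mod_group)

lemma compact_filtered_H: "compact_filtered_group H_nilspace"
  unfolding H_nilspace_def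
  by (auto intro!: compact_filtered_product compact_filtered_two_power compact_abelian_two_adic)

end

theory Submission
  imports Defs "HOL-Number_Theory.Cong"
begin

text \<open>Let \<open>\<phi>\<close> be a morphism from \<open>X\<close> to \<open>\<H>\<close> and let \<open>f\<close> be one of its coordinates with \<open>l = 2\<close>, a
  continuous map from \<open>X\<close> to the 2-adic integers. The point is that \<open>f\<close> modulo 2 factors through
  \<open>X / X\<^bsub>(2)\<^esub>\<close>, which is far too small to produce the quadratic cubes of \<open>\<H>\<close>.

  The invariance under \<open>X\<^bsub>(2)\<^esub>\<close> comes from torsion in \<open>X\<close> meeting torsion-freeness in \<open>\<H>\<close>. If \<open>e\<close> lies in
  the \<open>k\<close>-th filtration term, then \<open>x + (v\<^sub>1 \<dots> v\<^sub>k + v\<^bsub>k+1\<^esub> \<dots> v\<^bsub>2k\<^esub>) e\<close> is a \<open>2k\<close>-cube of \<open>X\<close>. The alternating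
  sum of its image over the vertices is the second difference \<open>f (x + 2e) - 2 f (x + e) + f x\<close>, and for a
  cube of \<open>\<H>\<close> this sum lies in the filtration term \<open>2\<^bsup>2k-2\<^esup> \<int>\<^sub>2\<close>. Since \<open>2e\<close> lies in the next filtration
  term, induction on the order of \<open>e\<close> (a power of 2) gives \<open>f (x + 2e) \<equiv> f x\<close> modulo \<open>2\<^sup>k\<close>, hence
  \<open>2 (f (x + e) - f x) \<equiv> 0\<close> modulo \<open>2\<^sup>k\<close>, and division by 2 yields \<open>f (x + e) \<equiv> f x\<close> modulo \<open>2\<^bsup>k-1\<^esup>\<close>.
  This is \<open>translation_invariance_level\<close>; the case \<open>k = 2\<close> is the one that matters.

  By compactness \<open>f\<close> modulo 2 depends on finitely many coordinates of \<open>X\<close>, so differences in \<open>X\<^bsub>(2)\<^esub>\<close> may be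
  taken to be torsion, and \<open>f\<close> modulo 2 depends only on the parities of finitely many coordinates
  \<open>(k, 1, j)\<close>, those of an index set \<open>S\<close> (\<open>morphism_parity_finite_dependence\<close>). Along a cube of \<open>X\<close> these
  parities are affine functions of \<open>v\<close> (\<open>X_cube_affine_mod_2\<close>). Now \<open>\<H>\<close> contains an \<open>n\<close>-cube
  with coordinate \<open>\<Sum>\<^bsub>i<j\<^esub> v\<^sub>i v\<^sub>j\<close> modulo 2 (\<open>H_cube_with_polynomial_coordinate\<close>); suppose that it lifts to
  a cube of \<open>X\<close>. If \<open>n\<close> exceeds the number \<open>2\<^bsup>|S|\<^esup>\<close> of parity patterns, two basis
  vertices \<open>e\<^sub>i\<close> and \<open>e\<^sub>j\<close> have the same parities. By affineness so do \<open>e\<^sub>i + e\<^sub>j\<close> and \<open>0\<close>, yet the quadratic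
  form takes the values 1 and 0 there.\<close>

section \<open>Powers and 2-adic coordinates\<close>

lemma nat_pow_product_filtered:
  assumes "i \<in> I"
  shows "(x [^]\<^bsub>product_filtered I A\<^esub> (n::nat)) i = x i [^]\<^bsub>A i\<^esub> n"
  using assms by (induction n) auto

lemma nat_pow_two_power_filtered:
  "x [^]\<^bsub>two_power_filtered A T l\<^esub> (n::nat) = x [^]\<^bsub>A\<^esub> n"
  by (induction n) auto

lemma mult_two_adic_group: "x \<otimes>\<^bsub>two_adic_group\<^esub> y = (\<lambda>n. (x n + y n) mod 2 ^ n)"
  by (simp add: two_adic_group_def fun_eq_iff)

lemma one_two_adic_group: "\<one>\<^bsub>two_adic_group\<^esub> = (\<lambda>n. 0)"
  by (simp add: two_adic_group_def fun_eq_iff)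

lemma nat_pow_two_adic_group: "(x [^]\<^bsub>two_adic_group\<^esub> (m::nat)) n = (int m * x n) mod 2 ^ n"
  by (induction m) (auto simp: mult_two_adic_group one_two_adic_group algebra_simps mod_simps)

lemma carrier_two_adic_group_compatible:
  assumes "x \<in> carrier two_adic_group"
  shows "x (Suc n) mod 2 ^ n = x n"
  using assms by (auto simp: two_adic_group_def)

lemma carrier_H_coordinate:
  assumes "x \<in> carrier H_nilspace" "1 \<le> l"
  shows "x (l, j) \<in> carrier two_adic_group"
  using assms by (auto simp: H_nilspace_def PiE_iff)

lemma group_X: "group X_nilspace" and group_H: "group H_nilspace"
  using compact_filtered_X compact_filtered_H
  by (auto simp: compact_filtered_group_def compact_abelian_group_def comm_group_def)

section \<open>Linear functionals on cubes\<close>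

text \<open>Both linear conditions on cubes below are checked on generators by this principle. The functional
  \<open>D\<close> takes representatives of residues and is therefore additive only modulo \<open>M\<close>, and
  its behaviour on inverses follows from \<open>D \<one> \<equiv> 0\<close>.\<close>
lemma generate_cong_zero:
  fixes D :: "'a \<Rightarrow> int"
  assumes G: "group G" and S: "S \<subseteq> carrier G"
    and add: "\<And>x y. x \<in> carrier G \<Longrightarrow> y \<in> carrier G \<Longrightarrow> [D (x \<otimes>\<^bsub>G\<^esub> y) = D x + D y] (mod M)"
    and gen: "\<And>x. x \<in> S \<Longrightarrow> [D x = 0] (mod M)"
    and x: "x \<in> generate G S"
  shows "[D x = 0] (mod M)"
proof -
  interpret group G by (rule G)
  have one: "[D \<one>\<^bsub>G\<^esub> = 0] (mod M)"
    using add[of "\<one>\<^bsub>G\<^esub>" "\<one>\<^bsub>G\<^esub>"] by (simp add: cong_iff_dvd_diff)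
  show ?thesis
    using x
  proof induction
    case (inv h)
    then have h: "h \<in> carrier G" using S by blast
    have "[D \<one>\<^bsub>G\<^esub> = D (inv\<^bsub>G\<^esub> h) + D h] (mod M)"
      using add[of "inv\<^bsub>G\<^esub> h" h] h by simp
    moreover have "[D (inv\<^bsub>G\<^esub> h) + D h = D (inv\<^bsub>G\<^esub> h) + 0] (mod M)"
      using gen[OF inv] cong_add cong_refl by blast
    ultimately show ?case using one by (metis add_0_right cong_sym cong_trans)
  next
    case (eng a b)
    then have "a \<in> carrier G" "b \<in> carrier G" using generate_in_carrier[OF S] by auto
    then show ?case using add[of a b] cong_add[OF eng.IH] by (metis add_0 cong_trans)
  qed (use one gen in auto)
qed

lemma cube_generator_carrier:
  assumes "compact_filtered_group A"
  shows "{cube_generator A n J a | J a. J \<subseteq> {1..n} \<and> a \<in> filtr A (card J)}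
    \<subseteq> carrier (product_group (cube_vertices n) (\<lambda>_. A))"
proof -
  interpret group A using assms
    by (simp add: compact_filtered_group_def compact_abelian_group_def comm_group_def)
  have "a \<in> carrier A" if "a \<in> filtr A i" for a i
    using assms that subgroup.subset unfolding compact_filtered_group_def by blast
  then show ?thesis by (auto simp: cube_generator_def)
qed

lemma monomial_eq:
  assumes "v \<in> cube_vertices n" "J \<subseteq> {1..n}"
  shows "(\<Prod>j\<in>J. v j) = of_bool (\<forall>j\<in>J. v j = 1)"
proof -
  have "finite J" using assms(2) finite_subset by blast
  moreover have "v j = 0 \<or> v j = 1" if "j \<in> J" for j
    using assms that by (auto simp: cube_vertices_def PiE_iff)
  ultimately show ?thesis
    by (auto intro!: prod.neutral intro: prod_zero)
qed

text \<open>The sum over the vertices of the product of factors \<open>(-1)\<^bsup>v i\<^esup>\<close> or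
  \<open>(-1)\<^bsup>v i\<^esup> v i\<close> is the product of the sums over one coordinate; a coordinate outside \<open>J\<close>
  contributes the factor \<open>1 - 1\<close>.\<close>
lemma alternating_sum_monomial:
  assumes J: "J \<subseteq> {1..n}"
  shows "(\<Sum>v\<in>cube_vertices n. (- 1) ^ (\<Sum>i = 1..n. v i) * int (\<Prod>j\<in>J. v j)) =
    (if J = {1..n} then (- 1) ^ n else 0)"
proof -
  have "(\<Sum>v\<in>cube_vertices n. (- 1) ^ (\<Sum>i = 1..n. v i) * int (\<Prod>j\<in>J. v j)) =
      (\<Sum>v\<in>cube_vertices n. \<Prod>i = 1..n. (- 1) ^ v i * (if i \<in> J then int (v i) else 1))"
  proof (rule sum.cong[OF refl])
    fix v
    have "(\<Prod>i = 1..n. if i \<in> J then int (v i) else 1) = (\<Prod>i\<in>{1..n} \<inter> J. int (v i))"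
      by (rule prod.inter_restrict[symmetric]) simp
    also have "{1..n} \<inter> J = J" using J by blast
    finally show "(- 1) ^ (\<Sum>i = 1..n. v i) * int (\<Prod>j\<in>J. v j) =
        (\<Prod>i = 1..n. (- 1) ^ v i * (if i \<in> J then int (v i) else 1))"
      by (simp add: prod.distrib power_sum)
  qed
  also have "\<dots> = (\<Prod>i = 1..n. \<Sum>x\<in>{0, 1::nat}. (- 1) ^ x * (if i \<in> J then int x else 1))"
    unfolding cube_vertices_def by (rule prod_sum_PiE[symmetric]) auto
  also have "\<dots> = (\<Prod>i = 1..n. if i \<in> J then - 1 else 0)"
    by (intro prod.cong) auto
  also have "\<dots> = (if J = {1..n} then (- 1) ^ n else 0)"
    using J by (auto simp: prod_zero_iff)
  finally show ?thesis .
qed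

text \<open>Of the monomials that generate the cubes, only the top one survives the alternating sum, and its
  coefficient lies in the \<open>N\<close>-th filtration term, which in this coordinate consists of the multiples of
  \<open>2\<^bsup>N - l\<^esup>\<close>. The bound \<open>n + l \<le> N\<close> makes them vanish modulo \<open>2\<^sup>n\<close>.\<close>
lemma H_cube_alternating_sum:
  assumes d: "d \<in> cubes H_nilspace N" and l: "1 \<le> l" and n: "n + l \<le> N"
  shows "[(\<Sum>v\<in>cube_vertices N. (- 1) ^ (\<Sum>i = 1..N. v i) * d v (l, j) n) = 0] (mod 2 ^ n)"
  using _ cube_generator_carrier[OF compact_filtered_H] _ _ d[unfolded cubes_def]
proof (rule generate_cong_zero)
  show "group (product_group (cube_vertices N) (\<lambda>_. H_nilspace))" using group_H by simp
next
  fix x y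
  let ?s = "\<lambda>v::nat \<Rightarrow> nat. (- 1 :: int) ^ (\<Sum>i = 1..N. v i)"
  have "[?s v * (x \<otimes>\<^bsub>product_group (cube_vertices N) (\<lambda>_. H_nilspace)\<^esub> y) v (l, j) n =
      ?s v * x v (l, j) n + ?s v * y v (l, j) n] (mod 2 ^ n)" if "v \<in> cube_vertices N" for v
    using l that by (simp add: H_nilspace_def mult_two_adic_group distrib_left[symmetric] cong_scalar_left)
  then show "[(\<Sum>v\<in>cube_vertices N. ?s v * (x \<otimes>\<^bsub>product_group (cube_vertices N) (\<lambda>_. H_nilspace)\<^esub> y) v (l, j) n) =
      (\<Sum>v\<in>cube_vertices N. ?s v * x v (l, j) n) + (\<Sum>v\<in>cube_vertices N. ?s v * y v (l, j) n)] (mod 2 ^ n)"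
    unfolding sum.distrib[symmetric] by (rule cong_sum)
next
  fix x
  let ?s = "\<lambda>v::nat \<Rightarrow> nat. (- 1 :: int) ^ (\<Sum>i = 1..N. v i)"
  assume "x \<in> {cube_generator H_nilspace N J a | J a. J \<subseteq> {1..N} \<and> a \<in> filtr H_nilspace (card J)}"
  then obtain J a where x: "x = cube_generator H_nilspace N J a"
    and J: "J \<subseteq> {1..N}" and a: "a \<in> filtr H_nilspace (card J)" by blast
  have "[?s v * x v (l, j) n = ?s v * int (\<Prod>j\<in>J. v j) * a (l, j) n] (mod 2 ^ n)"
    if "v \<in> cube_vertices N" for v
    using l that
    by (simp add: x cube_generator_def H_nilspace_def nat_pow_product_filtered
        nat_pow_two_power_filtered nat_pow_two_adic_group mult.assoc cong_scalar_left)
  then have "[(\<Sum>v\<in>cube_vertices N. ?s v * x v (l, j) n) =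
      (\<Sum>v\<in>cube_vertices N. ?s v * int (\<Prod>j\<in>J. v j) * a (l, j) n)] (mod 2 ^ n)"
    by (rule cong_sum)
  moreover have "(\<Sum>v\<in>cube_vertices N. ?s v * int (\<Prod>j\<in>J. v j) * a (l, j) n) =
      (if J = {1..N} then (- 1) ^ N else 0) * a (l, j) n"
    unfolding sum_distrib_right[symmetric] alternating_sum_monomial[OF J] ..
  moreover have "a (l, j) n = 0" if full: "J = {1..N}"
  proof -
    have "card J = N" using full by simp
    then obtain y where "a (l, j) = y [^]\<^bsub>two_adic_group\<^esub> ((2::nat) ^ (N - l))"
      using a l by (auto simp: H_nilspace_def PiE_iff)
    moreover have "(2::int) ^ n dvd 2 ^ (N - l) * y n" using n by (simp add: le_imp_power_dvd)
    ultimately show ?thesis by (simp add: nat_pow_two_adic_group)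
  qed
  ultimately show "[(\<Sum>v\<in>cube_vertices N. ?s v * x v (l, j) n) = 0] (mod 2 ^ n)"
    by (auto split: if_splits)
qed

section \<open>Invariance under torsion in the filtration\<close>

text \<open>Write \<open>f\<close> for the coordinate \<open>(l, j)\<close> of \<open>\<phi>\<close>. The statement for \<open>2e\<close>, one filtration step further and of half the order, controls
  \<open>f (x + 2e) - f x\<close> modulo \<open>2\<^sup>k\<close>; the second difference of \<open>f\<close> in direction \<open>e\<close> vanishes to at least that
  precision because \<open>k + l \<le> 2k\<close>. Their difference is \<open>2 (f (x + e) - f x)\<close>, and one factor 2 is lost when it is
  divided out. The result is thus weaker by one step for \<open>e\<close> than for \<open>2e\<close>, which matches the shift of
  the filtration and keeps the induction going.\<close>
lemma translation_invariance_level: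
  fixes A :: "('a, 'b) filtered_top_group_scheme"
  assumes A: "compact_filtered_group A"
    and double: "\<And>i a. a \<in> filtr A i \<Longrightarrow> a \<otimes>\<^bsub>A\<^esub> a \<in> filtr A (Suc i)"
    and \<phi>: "nilspace_morphism A H_nilspace \<phi>"
    and l: "1 \<le> l"
    and x: "x \<in> carrier A"
  shows "l \<le> k \<Longrightarrow> e \<in> filtr A k \<Longrightarrow> e [^]\<^bsub>A\<^esub> ((2::nat) ^ r) = \<one>\<^bsub>A\<^esub> \<Longrightarrow>
    \<phi> (x \<otimes>\<^bsub>A\<^esub> e) (l, j) (k - 1) = \<phi> x (l, j) (k - 1)"
proof (induction r arbitrary: e k)
  case 0
  interpret comm_group A using A by (simp add: compact_filtered_group_def compact_abelian_group_def)
  have "e \<in> carrier A"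
    using A 0 subgroup.subset unfolding compact_filtered_group_def by blast
  then have "e = \<one>\<^bsub>A\<^esub>" using 0 by simp
  then show ?case using x by simp
next
  case (Suc r)
  interpret comm_group A using A by (simp add: compact_filtered_group_def compact_abelian_group_def)
  have e: "e \<in> carrier A"
    using A Suc.prems subgroup.subset unfolding compact_filtered_group_def by blast
  define g where "g y = \<phi> y (l, j) k" for y
  have level: "g y mod 2 ^ (k - 1) = \<phi> y (l, j) (k - 1)" if "y \<in> carrier A" for y
  proof -
    have "\<phi> y \<in> carrier H_nilspace"
      using \<phi> that A compact_filtered_H
      by (auto simp: nilspace_morphism_def compact_filtered_group_def compact_abelian_group_def
          continuous_map_def)
    then show ?thesis
      using carrier_two_adic_group_compatible[OF carrier_H_coordinate[OF _ l], of "\<phi> y" j "k - 1"] l Suc.prems(1)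
      by (simp add: g_def)
  qed
  have "(e \<otimes>\<^bsub>A\<^esub> e) [^]\<^bsub>A\<^esub> ((2::nat) ^ r) = \<one>\<^bsub>A\<^esub>"
    using Suc.prems(3) e by (simp add: nat_pow_mult pow_mult_distrib m_comm mult_2)
  then have doubled: "g (x \<otimes>\<^bsub>A\<^esub> (e \<otimes>\<^bsub>A\<^esub> e)) = g x"
    using Suc.IH[of "Suc k" "e \<otimes>\<^bsub>A\<^esub> e"] double[OF Suc.prems(2)] Suc.prems(1) by (simp add: g_def)
  \<comment> \<open>Two disjoint blocks of \<open>k\<close> variables: \<open>e\<close> may be multiplied by either monomial, and the product of
    the two monomials is the top one.\<close>
  define J\<^sub>1 J\<^sub>2 where "J\<^sub>1 = {1..k}" and "J\<^sub>2 = {k + 1..2 * k}"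
  define m where "m J v = (\<Prod>i\<in>J. v i)" for J and v :: "nat \<Rightarrow> nat"
  define c where "c = (\<lambda>v\<in>cube_vertices (2 * k).
      x \<otimes>\<^bsub>A\<^esub> (e [^]\<^bsub>A\<^esub> m J\<^sub>1 v \<otimes>\<^bsub>A\<^esub> e [^]\<^bsub>A\<^esub> m J\<^sub>2 v))"
  have J: "J\<^sub>1 \<subseteq> {1..2 * k}" "J\<^sub>2 \<subseteq> {1..2 * k}" "card J\<^sub>1 = k" "card J\<^sub>2 = k" "J\<^sub>1 \<union> J\<^sub>2 = {1..2 * k}"
    "J\<^sub>1 \<inter> J\<^sub>2 = {}" "J\<^sub>1 \<noteq> {1..2 * k}" "J\<^sub>2 \<noteq> {1..2 * k}" "finite J\<^sub>1" "finite J\<^sub>2"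
    using l Suc.prems(1) by (auto simp: J\<^sub>1_def J\<^sub>2_def)
  have "c \<in> cubes A (2 * k)"
  proof -
    let ?P = "product_group (cube_vertices (2 * k)) (\<lambda>_. A)"
    let ?S = "{cube_generator A (2 * k) J a | J a. J \<subseteq> {1..2 * k} \<and> a \<in> filtr A (card J)}"
    have gen: "cube_generator A (2 * k) J a \<in> ?S" if "J \<subseteq> {1..2 * k}" "a \<in> filtr A (card J)" for J a
      using that by blast
    have x': "cube_generator A (2 * k) {} x \<in> ?S"
      by (rule gen) (use A x in \<open>simp_all add: compact_filtered_group_def\<close>)
    have e1: "cube_generator A (2 * k) J\<^sub>1 e \<in> ?S" and e2: "cube_generator A (2 * k) J\<^sub>2 e \<in> ?S"
      by (rule gen; use J Suc.prems(2) in simp)+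
    have "cube_generator A (2 * k) {} x \<otimes>\<^bsub>?P\<^esub>
        (cube_generator A (2 * k) J\<^sub>1 e \<otimes>\<^bsub>?P\<^esub> cube_generator A (2 * k) J\<^sub>2 e) \<in> generate ?P ?S"
      using x' e1 e2 by (intro generate.eng generate.incl)
    also have "cube_generator A (2 * k) {} x \<otimes>\<^bsub>?P\<^esub>
        (cube_generator A (2 * k) J\<^sub>1 e \<otimes>\<^bsub>?P\<^esub> cube_generator A (2 * k) J\<^sub>2 e) = c"
      using x by (auto simp: cube_generator_def c_def m_def)
    finally show ?thesis by (simp add: cubes_def)
  qed
  then have "cube_comp (2 * k) \<phi> c \<in> cubes H_nilspace (2 * k)"
    using \<phi> by (simp add: nilspace_morphism_def)
  then have "[(\<Sum>v\<in>cube_vertices (2 * k). (- 1) ^ (\<Sum>i = 1..2 * k. v i) *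
      cube_comp (2 * k) \<phi> c v (l, j) k) = 0] (mod 2 ^ k)"
    by (rule H_cube_alternating_sum) (use l Suc.prems(1) in auto)
  \<comment> \<open>The value at a vertex depends only on the two bits \<open>a = m J\<^sub>1 v\<close> and \<open>b = m J\<^sub>2 v\<close>. Expanded as a multilinear
    polynomial in \<open>a\<close> and \<open>b\<close>, it retains only the coefficient of \<open>ab\<close> in the alternating sum.\<close>
  also have "(\<Sum>v\<in>cube_vertices (2 * k). (- 1) ^ (\<Sum>i = 1..2 * k. v i) * cube_comp (2 * k) \<phi> c v (l, j) k) =
      (\<Sum>v\<in>cube_vertices (2 * k). (- 1) ^ (\<Sum>i = 1..2 * k. v i) * int (m {} v) * g x
        + (- 1) ^ (\<Sum>i = 1..2 * k. v i) * int (m J\<^sub>1 v) * (g (x \<otimes>\<^bsub>A\<^esub> e) - g x)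
        + (- 1) ^ (\<Sum>i = 1..2 * k. v i) * int (m J\<^sub>2 v) * (g (x \<otimes>\<^bsub>A\<^esub> e) - g x)
        + (- 1) ^ (\<Sum>i = 1..2 * k. v i) * int (m (J\<^sub>1 \<union> J\<^sub>2) v) *
            (g (x \<otimes>\<^bsub>A\<^esub> (e \<otimes>\<^bsub>A\<^esub> e)) - 2 * g (x \<otimes>\<^bsub>A\<^esub> e) + g x))"
  proof (rule sum.cong[OF refl])
    fix v assume v: "v \<in> cube_vertices (2 * k)"
    have "m J\<^sub>1 v = 0 \<or> m J\<^sub>1 v = 1" "m J\<^sub>2 v = 0 \<or> m J\<^sub>2 v = 1"
      using monomial_eq[OF v J(1)] monomial_eq[OF v J(2)] by (auto simp: m_def)
    moreover have "m (J\<^sub>1 \<union> J\<^sub>2) v = m J\<^sub>1 v * m J\<^sub>2 v"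
      unfolding m_def using J by (intro prod.union_disjoint)
    moreover have "m {} v = 1" by (simp add: m_def)
    moreover have "cube_comp (2 * k) \<phi> c v (l, j) k =
        g (x \<otimes>\<^bsub>A\<^esub> (e [^]\<^bsub>A\<^esub> m J\<^sub>1 v \<otimes>\<^bsub>A\<^esub> e [^]\<^bsub>A\<^esub> m J\<^sub>2 v))"
      using v by (simp add: cube_comp_def c_def g_def)
    ultimately show "(- 1) ^ (\<Sum>i = 1..2 * k. v i) * cube_comp (2 * k) \<phi> c v (l, j) k =
        (- 1) ^ (\<Sum>i = 1..2 * k. v i) * int (m {} v) * g x
        + (- 1) ^ (\<Sum>i = 1..2 * k. v i) * int (m J\<^sub>1 v) * (g (x \<otimes>\<^bsub>A\<^esub> e) - g x)
        + (- 1) ^ (\<Sum>i = 1..2 * k. v i) * int (m J\<^sub>2 v) * (g (x \<otimes>\<^bsub>A\<^esub> e) - g x)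
        + (- 1) ^ (\<Sum>i = 1..2 * k. v i) * int (m (J\<^sub>1 \<union> J\<^sub>2) v) *
            (g (x \<otimes>\<^bsub>A\<^esub> (e \<otimes>\<^bsub>A\<^esub> e)) - 2 * g (x \<otimes>\<^bsub>A\<^esub> e) + g x)"
      using x e by (elim disjE) (simp_all add: algebra_simps)
  qed
  also have "\<dots> = g (x \<otimes>\<^bsub>A\<^esub> (e \<otimes>\<^bsub>A\<^esub> e)) - 2 * g (x \<otimes>\<^bsub>A\<^esub> e) + g x"
    unfolding sum.distrib sum_distrib_right[symmetric] m_def J(5)
      alternating_sum_monomial[OF J(1)] alternating_sum_monomial[OF J(2)]
      alternating_sum_monomial[OF empty_subsetI] alternating_sum_monomial[OF subset_refl]
    using J l Suc.prems(1) by simp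
  finally have "2 ^ k dvd 2 * (g x - g (x \<otimes>\<^bsub>A\<^esub> e))"
    by (simp add: doubled cong_iff_dvd_diff algebra_simps)
  then have "2 * 2 ^ (k - 1) dvd 2 * (g x - g (x \<otimes>\<^bsub>A\<^esub> e))"
    using l Suc.prems(1) by (simp flip: power_Suc)
  then have "2 ^ (k - 1) dvd g x - g (x \<otimes>\<^bsub>A\<^esub> e)"
    unfolding dvd_mult_cancel_left by simp
  then have "g x mod 2 ^ (k - 1) = g (x \<otimes>\<^bsub>A\<^esub> e) mod 2 ^ (k - 1)"
    by (simp add: mod_eq_dvd_iff)
  then show ?case using level x e by simp
qed

section \<open>Finite dependence of maps to discrete spaces\<close>

text \<open>Around each point \<open>f\<close> is constant on a box that restricts only finitely many coordinates. Finitely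
  many such boxes cover the space, and the coordinates that they restrict suffice: a point that agrees
  there with a point of a box lies in that box.\<close>
lemma continuous_to_discrete_finite_support:
  assumes cpt: "compact_space (product_topology T I)"
    and f: "continuous_map (product_topology T I) (discrete_topology D) f"
  shows "\<exists>S\<subseteq>I. finite S \<and> (\<forall>x\<in>topspace (product_topology T I). \<forall>y\<in>topspace (product_topology T I).
       (\<forall>i\<in>S. x i = y i) \<longrightarrow> f x = f y)"
proof -
  let ?P = "product_topology T I"
  define supp where "supp U = {i \<in> I. U i \<noteq> topspace (T i)}" for U
  define good where "good U \<longleftrightarrow> finite (supp U) \<and> (\<forall>i\<in>I. openin (T i) (U i)) \<and>
      (\<forall>x\<in>Pi\<^sub>E I U. \<forall>y\<in>Pi\<^sub>E I U. f x = f y)" for U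
  have ex: "\<exists>U. good U \<and> x \<in> Pi\<^sub>E I U" if x: "x \<in> topspace ?P" for x
  proof -
    have "f x \<in> D" using f x by (auto simp: continuous_map_def)
    then have "openin ?P {y \<in> topspace ?P. f y \<in> {f x}}"
      by (intro openin_continuous_map_preimage[OF f]) simp
    moreover have "x \<in> {y \<in> topspace ?P. f y \<in> {f x}}" using x by simp
    ultimately have "\<exists>U. finite (supp U) \<and> (\<forall>i\<in>I. openin (T i) (U i)) \<and> x \<in> Pi\<^sub>E I U \<and>
        Pi\<^sub>E I U \<subseteq> {y \<in> topspace ?P. f y \<in> {f x}}"
      unfolding openin_product_topology_alt supp_def by (rule bspec)
    then obtain U where "finite (supp U)" "\<forall>i\<in>I. openin (T i) (U i)" "x \<in> Pi\<^sub>E I U"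
      and U: "Pi\<^sub>E I U \<subseteq> {y \<in> topspace ?P. f y \<in> {f x}}"
      by (elim exE conjE)
    moreover have "\<forall>y\<in>Pi\<^sub>E I U. \<forall>z\<in>Pi\<^sub>E I U. f y = f z"
    proof (intro ballI)
      fix y z assume "y \<in> Pi\<^sub>E I U" "z \<in> Pi\<^sub>E I U"
      then show "f y = f z" using subsetD[OF U, of y] subsetD[OF U, of z] by simp
    qed
    ultimately show ?thesis unfolding good_def by (intro exI[of _ U] conjI)
  qed
  have "openin ?P W" if "W \<in> (Pi\<^sub>E I) ` Collect good" for W
    using that by (auto simp: openin_PiE_gen good_def supp_def)
  moreover have "topspace ?P \<subseteq> \<Union> ((Pi\<^sub>E I) ` Collect good)"
    using ex by blast
  ultimately have "\<exists>\<F>. finite \<F> \<and> \<F> \<subseteq> (Pi\<^sub>E I) ` Collect good \<and> topspace ?P \<subseteq> \<Union>\<F>"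
    by (intro cpt[unfolded compact_space_alt, THEN spec, THEN mp] conjI ballI)
  then obtain \<U> where \<U>: "finite \<U>" "\<U> \<subseteq> Collect good" "topspace ?P \<subseteq> \<Union> (Pi\<^sub>E I ` \<U>)"
    by (metis finite_subset_image)
  show ?thesis
  proof (intro exI[of _ "\<Union> (supp ` \<U>)"] conjI ballI impI)
    show "finite (\<Union> (supp ` \<U>))" "\<Union> (supp ` \<U>) \<subseteq> I"
      using \<U> by (auto simp: good_def supp_def)
    fix x y assume x: "x \<in> topspace ?P" and y: "y \<in> topspace ?P"
      and agree: "\<forall>i\<in>\<Union> (supp ` \<U>). x i = y i"
    obtain U where U: "U \<in> \<U>" "x \<in> Pi\<^sub>E I U" using x \<U> by blast
    have "y i \<in> U i" if "i \<in> I" for i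
    proof (cases "i \<in> supp U")
      case True
      then have "x i = y i" using agree U(1) by blast
      then show ?thesis using U(2) that by (auto simp: PiE_iff)
    next
      case False
      then show ?thesis using y that by (auto simp: supp_def PiE_iff)
    qed
    then have "y \<in> Pi\<^sub>E I U" using y by (auto simp: PiE_iff)
    moreover have "\<forall>x\<in>Pi\<^sub>E I U. \<forall>y\<in>Pi\<^sub>E I U. f x = f y"
      using subsetD[OF \<U>(2) U(1)] unfolding mem_Collect_eq good_def by (elim conjE)
    ultimately show "f x = f y" using U(2) by blast
  qed
qed

section \<open>The group nilspace \<open>X\<close>\<close>

lemma filtr_X_iff:
  "a \<in> filtr X_nilspace i \<longleftrightarrow> a \<in> extensional {(k, l, j). 1 \<le> l \<and> l \<le> k} \<and>
    (\<forall>k l j. 1 \<le> l \<longrightarrow> l \<le> k \<longrightarrow> (\<exists>y. a (k, l, j) = (2 ^ (i - l) * y) mod 2 ^ (k - l + 1)))"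
proof -
  have "(\<exists>y\<in>carrier (integer_mod_group (2 ^ r)). t = y [^]\<^bsub>integer_mod_group (2 ^ r)\<^esub> ((2::nat) ^ m)) \<longleftrightarrow>
      (\<exists>y. t = (2 ^ m * y) mod 2 ^ r)" for t r m
  proof
    assume "\<exists>y. t = (2 ^ m * y) mod 2 ^ r"
    then obtain y where "t = (2 ^ m * y) mod 2 ^ r" by blast
    then show "\<exists>y\<in>carrier (integer_mod_group (2 ^ r)). t = y [^]\<^bsub>integer_mod_group (2 ^ r)\<^esub> ((2::nat) ^ m)"
      by (intro bexI[of _ "y mod 2 ^ r"]) (auto simp: carrier_integer_mod_group mod_simps)
  qed auto
  then have factor: "t \<in> filtr (cyclic_filtered (2 ^ r) l) i \<longleftrightarrow> (\<exists>y. t = (2 ^ (i - l) * y) mod 2 ^ r)" for t r l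
    by (simp only: cyclic_filtered_def two_power_filtered_simps image_iff)
  have "a \<in> filtr X_nilspace i \<longleftrightarrow> a \<in> extensional {(k, l, j). 1 \<le> l \<and> l \<le> k} \<and>
      (\<forall>k l j. 1 \<le> l \<longrightarrow> l \<le> k \<longrightarrow> a (k, l, j) \<in> filtr (cyclic_filtered (2 ^ (k - l + 1)) l) i)"
    unfolding X_nilspace_def product_filtered_simps PiE_iff
    by (simp only: Ball_def split_paired_All mem_Collect_eq case_prod_conv) blast
  then show ?thesis unfolding factor .
qed

lemma carrier_X_iff:
  "x \<in> carrier X_nilspace \<longleftrightarrow> x \<in> extensional {(k, l, j). 1 \<le> l \<and> l \<le> k} \<and>
    (\<forall>k l j. 1 \<le> l \<longrightarrow> l \<le> k \<longrightarrow> x (k, l, j) \<in> {0..<2 ^ (k - l + 1)})"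
proof -
  have factor: "carrier (cyclic_filtered (2 ^ r) l) = {0..<2 ^ r}" for r l
    by (simp add: cyclic_filtered_def carrier_integer_mod_group)
  have "x \<in> carrier X_nilspace \<longleftrightarrow> x \<in> extensional {(k, l, j). 1 \<le> l \<and> l \<le> k} \<and>
      (\<forall>k l j. 1 \<le> l \<longrightarrow> l \<le> k \<longrightarrow> x (k, l, j) \<in> carrier (cyclic_filtered (2 ^ (k - l + 1)) l))"
    unfolding X_nilspace_def product_filtered_simps PiE_iff
    by (simp only: Ball_def split_paired_All mem_Collect_eq case_prod_conv) blast
  then show ?thesis unfolding factor .
qed

lemma mult_X_coordinate:
  assumes "1 \<le> l" "l \<le> k"
  shows "(x \<otimes>\<^bsub>X_nilspace\<^esub> y) (k, l, j) = (x (k, l, j) + y (k, l, j)) mod 2 ^ (k - l + 1)"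
  using assms by (simp add: X_nilspace_def cyclic_filtered_def)

lemma one_X_coordinate:
  assumes "1 \<le> l" "l \<le> k"
  shows "\<one>\<^bsub>X_nilspace\<^esub> (k, l, j) = 0"
  using assms by (simp add: X_nilspace_def cyclic_filtered_def)

lemma nat_pow_X_coordinate:
  assumes "1 \<le> l" "l \<le> k"
  shows "(x [^]\<^bsub>X_nilspace\<^esub> (m::nat)) (k, l, j) = (int m * x (k, l, j)) mod 2 ^ (k - l + 1)"
  using assms
  by (simp add: X_nilspace_def nat_pow_product_filtered cyclic_filtered_def nat_pow_two_power_filtered)

text \<open>Doubling raises the filtration degree because each factor \<open>l\<close> is filtered by powers of 2, with
  one more factor 2 at each step from degree \<open>l\<close> on.\<close>
lemma filtr_X_double:
  assumes a: "a \<in> filtr X_nilspace i"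
  shows "a \<otimes>\<^bsub>X_nilspace\<^esub> a \<in> filtr X_nilspace (Suc i)"
  unfolding filtr_X_iff
proof (intro conjI allI impI)
  fix k l j :: nat
  assume l: "1 \<le> l" "l \<le> k"
  obtain y where y: "a (k, l, j) = (2 ^ (i - l) * y) mod 2 ^ (k - l + 1)"
    using a l unfolding filtr_X_iff by blast
  show "\<exists>y. (a \<otimes>\<^bsub>X_nilspace\<^esub> a) (k, l, j) = (2 ^ (Suc i - l) * y) mod 2 ^ (k - l + 1)"
  proof (cases "l \<le> i")
    case True
    have "(p mod m + p mod m) mod m = (2 * p) mod m" for p m :: int
      by (metis mod_add_eq mult_2)
    with True show ?thesis
      unfolding mult_X_coordinate[OF l] y by (intro exI[of _ y]) (simp add: Suc_diff_le mult.assoc)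
  next
    case False
    then show ?thesis
      unfolding mult_X_coordinate[OF l] by (intro exI[of _ "a (k, l, j) + a (k, l, j)"]) simp
  qed
qed (simp add: X_nilspace_def)

text \<open>On the finite set of relevant coordinates, \<open>y - x\<close> lies in \<open>X\<^bsub>(2)\<^esub>\<close> as soon as it is even at those with
  \<open>l = 1\<close>, since the second filtration term is the whole factor for \<open>l \<ge> 2\<close>. So invariance under torsion
  elements of \<open>X\<^bsub>(2)\<^esub>\<close> applies with \<open>l = k = 2\<close>.\<close>
lemma morphism_parity_finite_dependence:
  assumes \<phi>: "nilspace_morphism X_nilspace H_nilspace \<phi>"
  shows "\<exists>S\<subseteq>{(k, l, j). 1 \<le> l \<and> l \<le> k}. finite S \<and>
    (\<forall>x\<in>carrier X_nilspace. \<forall>y\<in>carrier X_nilspace.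
      (\<forall>k j. (k, 1, j) \<in> S \<longrightarrow> [x (k, 1, j) = y (k, 1, j)] (mod 2)) \<longrightarrow>
      \<phi> x (2, j\<^sub>0) 1 = \<phi> y (2, j\<^sub>0) 1)"
proof -
  let ?I = "{(k, l, j). 1 \<le> l \<and> l \<le> k} :: (nat \<times> nat \<times> nat) set"
  define f where "f x = \<phi> x (2, j\<^sub>0) 1" for x
  have f: "continuous_map (topo X_nilspace) (discrete_topology (carrier (integer_mod_group (2 ^ 1)))) f"
  proof -
    have "continuous_map (topo X_nilspace) (product_topology (\<lambda>_. two_adic_topology) {(l, j). 1 \<le> l}) \<phi>"
      using \<phi> by (simp add: nilspace_morphism_def H_nilspace_def case_prod_unfold)
    then have "continuous_map (topo X_nilspace) two_adic_topology (\<lambda>x. \<phi> x (2, j\<^sub>0))"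
      by (rule continuous_map_componentwise[THEN iffD1, THEN conjunct2, THEN bspec]) simp
    then have "continuous_map (topo X_nilspace)
        (product_topology (\<lambda>n. discrete_topology (carrier (integer_mod_group (2 ^ n)))) UNIV) (\<lambda>x. \<phi> x (2, j\<^sub>0))"
      by (simp only: two_adic_topology_def continuous_map_in_subtopology)
    then have "continuous_map (topo X_nilspace) (discrete_topology (carrier (integer_mod_group (2 ^ 1))))
        (\<lambda>x. \<phi> x (2, j\<^sub>0) 1)"
      by (rule continuous_map_componentwise[THEN iffD1, THEN conjunct2, THEN bspec]) simp
    then show ?thesis by (simp only: f_def[abs_def])
  qed
  define T where "T = (\<lambda>s. topo (case s of (k, l, j :: nat) \<Rightarrow> cyclic_filtered (2 ^ (k - l + 1)) l))"
  have topo_X: "topo X_nilspace = product_topology T ?I"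
    by (simp only: X_nilspace_def product_filtered_simps T_def)
  have cpt: "compact_space (product_topology T ?I)"
    and top_X: "topspace (product_topology T ?I) = carrier X_nilspace"
    using compact_filtered_X
    by (simp_all only: compact_filtered_group_def compact_abelian_group_def topo_X)
  obtain S where S: "finite S" "S \<subseteq> ?I"
    and f_S: "\<forall>x\<in>carrier X_nilspace. \<forall>y\<in>carrier X_nilspace. (\<forall>s\<in>S. x s = y s) \<longrightarrow> f x = f y"
    using continuous_to_discrete_finite_support[OF cpt f[unfolded topo_X], unfolded top_X]
    by (elim exE conjE)
  interpret X: group X_nilspace by (rule group_X)
  have f_mod: "f x = f y" if x: "x \<in> carrier X_nilspace" and y: "y \<in> carrier X_nilspace"
    and xy: "\<And>k j. (k, 1, j) \<in> S \<Longrightarrow> [x (k, 1, j) = y (k, 1, j)] (mod 2)" for x y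
  proof -
    \<comment> \<open>Correct \<open>x\<close> to \<open>y\<close> on \<open>S\<close> alone: the correction has finite support, hence finite order.\<close>
    define e where "e = (\<lambda>s\<in>?I. if s \<in> S then case s of (k, l, j) \<Rightarrow> (y s - x s) mod 2 ^ (k - l + 1) else 0)"
    have e_val: "e (k, l, j) = (if (k, l, j) \<in> S then (y (k, l, j) - x (k, l, j)) mod 2 ^ (k - l + 1) else 0)"
      if "1 \<le> l" "l \<le> k" for k l j
      using that by (simp add: e_def)
    have e_ext: "e \<in> extensional ?I" by (simp add: e_def)
    have e: "e \<in> carrier X_nilspace"
      unfolding carrier_X_iff using e_ext by (simp add: e_val)
    have "e \<in> filtr X_nilspace 2"
      unfolding filtr_X_iff
    proof (intro conjI allI impI e_ext)
      fix k l j :: nat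
      assume l: "1 \<le> l" "l \<le> k"
      consider "(k, l, j) \<notin> S" | "(k, l, j) \<in> S" "2 \<le> l" | "(k, l, j) \<in> S" "l = 1"
        using l by linarith
      then show "\<exists>z. e (k, l, j) = (2 ^ (2 - l) * z) mod 2 ^ (k - l + 1)"
      proof cases
        case 1
        then show ?thesis unfolding e_val[OF l] by (intro exI[of _ 0]) simp
      next
        case 2
        then show ?thesis unfolding e_val[OF l] by (intro exI[of _ "y (k, l, j) - x (k, l, j)"]) simp
      next
        case 3
        then have "[x (k, l, j) = y (k, l, j)] (mod 2)" using xy by blast
        then have "2 dvd y (k, l, j) - x (k, l, j)"
          by (metis cong_iff_dvd_diff cong_sym)
        then obtain z where "y (k, l, j) - x (k, l, j) = 2 * z" unfolding dvd_def by blast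
        then show ?thesis unfolding e_val[OF l] using 3 by (intro exI[of _ z]) simp
      qed
    qed
    moreover obtain r where "e [^]\<^bsub>X_nilspace\<^esub> ((2::nat) ^ r) = \<one>\<^bsub>X_nilspace\<^esub>"
    proof
      \<comment> \<open>A coordinate \<open>(k, l, j)\<close> has exponent \<open>2\<^bsup>k - l + 1\<^esup>\<close>, and \<open>k - l + 1 \<le> k < r\<close> on \<open>S\<close>.\<close>
      define r where "r = Max (insert 0 (fst ` S)) + 1"
      have fst_le: "k + 1 \<le> r" if "(k, l, j) \<in> S" for k l j
      proof -
        have "k \<in> insert 0 (fst ` S)" using that by force
        then show ?thesis using S(1) by (simp add: r_def)
      qed
      have "(e [^]\<^bsub>X_nilspace\<^esub> ((2::nat) ^ r)) (k, l, j) = \<one>\<^bsub>X_nilspace\<^esub> (k, l, j)"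
        if l: "1 \<le> l" "l \<le> k" for k l j
      proof -
        have "(2 ^ r * e (k, l, j)) mod 2 ^ (k - l + 1) = 0"
        proof (cases "(k, l, j) \<in> S")
          case True
          then have "(2::int) ^ (k - l + 1) dvd 2 ^ r" using fst_le[OF True] l by (intro le_imp_power_dvd) auto
          then show ?thesis by (simp only: dvd_imp_mod_0 dvd_mult2)
        next
          case False
          then show ?thesis by (simp add: e_val[OF l])
        qed
        then show ?thesis
          using l unfolding nat_pow_X_coordinate[OF l] one_X_coordinate[OF l] by simp
      qed
      moreover have "e [^]\<^bsub>X_nilspace\<^esub> ((2::nat) ^ r) \<in> extensional ?I" "\<one>\<^bsub>X_nilspace\<^esub> \<in> extensional ?I"
        using X.nat_pow_closed[OF e] X.one_closed unfolding carrier_X_iff by blast+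
      ultimately show "e [^]\<^bsub>X_nilspace\<^esub> ((2::nat) ^ r) = \<one>\<^bsub>X_nilspace\<^esub>"
        by (intro extensionalityI[where A = ?I]) auto
    qed
    ultimately have "f (x \<otimes>\<^bsub>X_nilspace\<^esub> e) = f x"
      using translation_invariance_level[OF compact_filtered_X filtr_X_double \<phi>, of 2 x 2 e r j\<^sub>0] x
      by (simp add: f_def)
    moreover have "f (x \<otimes>\<^bsub>X_nilspace\<^esub> e) = f y"
    proof (rule f_S[rule_format])
      fix s assume s: "s \<in> S"
      obtain k l j where klj: "s = (k, l, j)" by (cases s)
      then have l: "1 \<le> l" "l \<le> k" using s S(2) by auto
      have "0 \<le> y s" "y s < 2 ^ (k - l + 1)"
        using y l unfolding carrier_X_iff klj by auto
      then show "(x \<otimes>\<^bsub>X_nilspace\<^esub> e) s = y s"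
        using s l unfolding klj mult_X_coordinate[OF l] e_val[OF l]
        by (simp add: mod_add_right_eq)
    qed (use x e y in auto)
    ultimately show ?thesis by simp
  qed
  show ?thesis
  proof (intro exI[of _ S] conjI S ballI impI)
    fix x y
    assume "x \<in> carrier X_nilspace" "y \<in> carrier X_nilspace"
      "\<forall>k j. (k, 1, j) \<in> S \<longrightarrow> [x (k, 1, j) = y (k, 1, j)] (mod 2)"
    then show "\<phi> x (2, j\<^sub>0) 1 = \<phi> y (2, j\<^sub>0) 1"
      using f_mod[of x y] unfolding f_def by blast
  qed
qed

section \<open>Values of cubes at vertices\<close>

definition vertex :: "nat \<Rightarrow> nat set \<Rightarrow> nat \<Rightarrow> nat" where
  "vertex n P = (\<lambda>i\<in>{1..n}. of_bool (i \<in> P))"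

lemma vertex_in_cube_vertices: "vertex n P \<in> cube_vertices n"
  by (auto simp: vertex_def cube_vertices_def)

lemma monomial_vertex:
  assumes "J \<subseteq> {1..n}"
  shows "(\<Prod>j\<in>J. vertex n P j) = of_bool (J \<subseteq> P)"
proof -
  have "vertex n P j = of_bool (j \<in> P)" if "j \<in> J" for j
    using that assms by (auto simp: vertex_def)
  then show ?thesis
    unfolding monomial_eq[OF vertex_in_cube_vertices assms] by auto
qed

text \<open>In the factors with \<open>l = 1\<close> the filtration term of any degree at least 2 consists of even elements,
  so modulo 2 only the constant and the linear monomials of a cube remain.\<close>
lemma X_cube_affine_mod_2:
  assumes c: "c \<in> cubes X_nilspace n" and k: "1 \<le> k" and i: "i \<noteq> i'"
  shows "[c (vertex n {i, i'}) (k, 1, j) + c (vertex n {}) (k, 1, j)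
    - c (vertex n {i}) (k, 1, j) - c (vertex n {i'}) (k, 1, j) = 0] (mod 2)"
  using _ cube_generator_carrier[OF compact_filtered_X] _ _ c[unfolded cubes_def]
proof (rule generate_cong_zero)
  show "group (product_group (cube_vertices n) (\<lambda>_. X_nilspace))" using group_X by simp
next
  have two: "(2::int) dvd 2 ^ k" using k by (simp add: dvd_power)
  {
    fix x y :: "(nat \<Rightarrow> nat) \<Rightarrow> nat \<times> nat \<times> nat \<Rightarrow> int"
    have "[(x \<otimes>\<^bsub>product_group (cube_vertices n) (\<lambda>_. X_nilspace)\<^esub> y) v (k, 1, j) =
        x v (k, 1, j) + y v (k, 1, j)] (mod 2)" if "v \<in> cube_vertices n" for v
      using k that two
      by (simp add: X_nilspace_def cyclic_filtered_def cong_def mod_mod_cancel)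
    note add = this[OF vertex_in_cube_vertices]
    show "[(x \<otimes>\<^bsub>product_group (cube_vertices n) (\<lambda>_. X_nilspace)\<^esub> y) (vertex n {i, i'}) (k, 1, j)
      + (x \<otimes>\<^bsub>product_group (cube_vertices n) (\<lambda>_. X_nilspace)\<^esub> y) (vertex n {}) (k, 1, j)
      - (x \<otimes>\<^bsub>product_group (cube_vertices n) (\<lambda>_. X_nilspace)\<^esub> y) (vertex n {i}) (k, 1, j)
      - (x \<otimes>\<^bsub>product_group (cube_vertices n) (\<lambda>_. X_nilspace)\<^esub> y) (vertex n {i'}) (k, 1, j) =
      x (vertex n {i, i'}) (k, 1, j) + x (vertex n {}) (k, 1, j)
        - x (vertex n {i}) (k, 1, j) - x (vertex n {i'}) (k, 1, j) +
      (y (vertex n {i, i'}) (k, 1, j) + y (vertex n {}) (k, 1, j)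
        - y (vertex n {i}) (k, 1, j) - y (vertex n {i'}) (k, 1, j))] (mod 2)"
      by (rule cong_trans[OF cong_diff[OF cong_diff[OF cong_add[OF add add] add] add]])
        (simp add: algebra_simps)
  }
  fix x
  assume "x \<in> {cube_generator X_nilspace n J a | J a. J \<subseteq> {1..n} \<and> a \<in> filtr X_nilspace (card J)}"
  then obtain J a where x: "x = cube_generator X_nilspace n J a"
    and J: "J \<subseteq> {1..n}" and a: "a \<in> filtr X_nilspace (card J)" by blast
  have gen_mod_2: "[x (vertex n P) (k, 1, j) = of_bool (J \<subseteq> P) * a (k, 1, j)] (mod 2)" for P
    using k two
    by (simp add: x cube_generator_def vertex_in_cube_vertices monomial_vertex[OF J] X_nilspace_def
        nat_pow_product_filtered cyclic_filtered_def nat_pow_two_power_filtered cong_def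
        mod_mod_cancel del: of_nat_prod)
  have "[x (vertex n {i, i'}) (k, 1, j) + x (vertex n {}) (k, 1, j)
      - x (vertex n {i}) (k, 1, j) - x (vertex n {i'}) (k, 1, j) =
      of_bool (J \<subseteq> {i, i'}) * a (k, 1, j) + of_bool (J \<subseteq> {}) * a (k, 1, j)
      - of_bool (J \<subseteq> {i}) * a (k, 1, j) - of_bool (J \<subseteq> {i'}) * a (k, 1, j)] (mod 2)"
    by (intro cong_add cong_diff gen_mod_2)
  moreover have "[of_bool (J \<subseteq> {i, i'}) * a (k, 1, j) + of_bool (J \<subseteq> {}) * a (k, 1, j)
      - of_bool (J \<subseteq> {i}) * a (k, 1, j) - of_bool (J \<subseteq> {i'}) * a (k, 1, j) = 0] (mod 2)"
  proof (cases "card J \<le> 1")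
    case True
    moreover have "finite J" using J finite_subset by blast
    ultimately consider "J = {}" | u where "J = {u}"
      by (metis card_0_eq card_1_singletonE le_neq_implies_less less_one)
    then show ?thesis using i by cases (auto simp: cong_0_iff)
  next
    case False
    obtain y where "a (k, 1, j) = (2 ^ (card J - 1) * y) mod 2 ^ (k - 1 + 1)"
      using a k unfolding filtr_X_iff by blast
    moreover have "(2::int) dvd 2 ^ (card J - 1)" using False by (simp add: dvd_power)
    ultimately have "2 dvd a (k, 1, j)" using two k by (simp add: dvd_mod_iff)
    then show ?thesis by (simp add: cong_0_iff)
  qed
  ultimately show "[x (vertex n {i, i'}) (k, 1, j) + x (vertex n {}) (k, 1, j)
      - x (vertex n {i}) (k, 1, j) - x (vertex n {i'}) (k, 1, j) = 0] (mod 2)"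
    by (rule cong_trans)
qed

text \<open>In a coordinate with index \<open>l\<close> the filtration is still the whole group in degree \<open>l\<close>, so every
  monomial of degree at most \<open>l\<close> may have the coefficient 1.\<close>
lemma H_cube_with_polynomial_coordinate:
  assumes F: "finite F" and l: "1 \<le> l" and deg: "\<And>J. J \<in> F \<Longrightarrow> J \<subseteq> {1..n} \<and> card J \<le> l"
  shows "\<exists>d\<in>cubes H_nilspace n. \<forall>v\<in>cube_vertices n. d v (l, j) 1 = int (\<Sum>J\<in>F. \<Prod>i\<in>J. v i) mod 2"
  using F deg
proof (induction F)
  case empty
  have "\<one>\<^bsub>product_group (cube_vertices n) (\<lambda>_. H_nilspace)\<^esub> \<in> cubes H_nilspace n"
    unfolding cubes_def by (rule generate.one)
  then show ?case
    by (rule rev_bexI) (use l in \<open>simp add: H_nilspace_def one_two_adic_group\<close>)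
next
  case (insert J F)
  then obtain d where d: "d \<in> cubes H_nilspace n"
    "\<And>v. v \<in> cube_vertices n \<Longrightarrow> d v (l, j) 1 = int (\<Sum>J\<in>F. \<Prod>i\<in>J. v i) mod 2" by auto
  define u where "u = (\<lambda>s\<in>{(l, j). 1 \<le> l}. if s = (l, j) then (\<lambda>m::nat. 1 mod 2 ^ m :: int)
      else \<one>\<^bsub>two_adic_group\<^esub>)"
  interpret T: group two_adic_group
    using compact_abelian_two_adic by (simp add: compact_abelian_group_def comm_group_def)
  have one: "(\<lambda>m::nat. 1 mod 2 ^ m :: int) \<in> carrier two_adic_group"
    by (auto simp: two_adic_group_def carrier_integer_mod_group mod_mod_cancel)
  have "u \<in> filtr H_nilspace (card J)"
    using one insert.prems[of J] l
    by (auto simp: u_def H_nilspace_def PiE_iff image_iff intro: exI[of _ "\<one>\<^bsub>two_adic_group\<^esub>"]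
        bexI[of _ "\<one>\<^bsub>two_adic_group\<^esub>"] bexI[of _ "(\<lambda>m::nat. 1 mod 2 ^ m :: int)"])
  then have "cube_generator H_nilspace n J u \<otimes>\<^bsub>product_group (cube_vertices n) (\<lambda>_. H_nilspace)\<^esub> d
      \<in> cubes H_nilspace n"
    using d(1) insert.prems[of J] unfolding cubes_def by (intro generate.eng) (auto intro: generate.incl)
  then show ?case
  proof (rule rev_bexI, intro ballI)
    fix v assume v: "v \<in> cube_vertices n"
    have "(cube_generator H_nilspace n J u \<otimes>\<^bsub>product_group (cube_vertices n) (\<lambda>_. H_nilspace)\<^esub> d) v (l, j) 1
        = (int (\<Prod>i\<in>J. v i) + d v (l, j) 1) mod 2"
      using v l
      by (simp add: cube_generator_def H_nilspace_def nat_pow_product_filtered nat_pow_two_power_filtered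
          mult_two_adic_group nat_pow_two_adic_group u_def mod_simps del: of_nat_prod)
    then show "(cube_generator H_nilspace n J u \<otimes>\<^bsub>product_group (cube_vertices n) (\<lambda>_. H_nilspace)\<^esub> d) v (l, j) 1
        = int (\<Sum>J\<in>insert J F. \<Prod>i\<in>J. v i) mod 2"
      using insert.hyps d(2)[OF v] by (simp add: mod_simps)
  qed
qed

section \<open>Non-existence of a cube-surjective morphism\<close>

theorem theorem8p10:
  shows "\<not> (\<exists>\<phi>. nilspace_morphism X_nilspace H_nilspace \<phi> \<and>
              cube_surjective X_nilspace H_nilspace \<phi>)"
proof
  assume "\<exists>\<phi>. nilspace_morphism X_nilspace H_nilspace \<phi> \<and> cube_surjective X_nilspace H_nilspace \<phi>"
  then obtain \<phi> where \<phi>: "nilspace_morphism X_nilspace H_nilspace \<phi>"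
    and surj: "cube_surjective X_nilspace H_nilspace \<phi>" by blast
  define f where "f x = \<phi> x (2, 0) 1" for x
  obtain S where S: "finite S" "S \<subseteq> {(k, l, j). 1 \<le> l \<and> l \<le> k}"
    and f_mod: "\<forall>x\<in>carrier X_nilspace. \<forall>y\<in>carrier X_nilspace.
      (\<forall>k j. (k, 1, j) \<in> S \<longrightarrow> [x (k, 1, j) = y (k, 1, j)] (mod 2)) \<longrightarrow> f x = f y"
    using morphism_parity_finite_dependence[OF \<phi>, of 0] unfolding f_def by (elim exE conjE)
  \<comment> \<open>One more direction than there are parity patterns on \<open>S\<close>.\<close>
  define n where "n = 2 ^ card S + (1::nat)"
  define F where "F = {J. J \<subseteq> {1..n} \<and> card J = 2}"
  have F: "finite F" by (rule finite_subset[of _ "Pow {1..n}"]) (auto simp: F_def)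
  obtain d where d: "d \<in> cubes H_nilspace n"
    and d_val: "\<And>v. v \<in> cube_vertices n \<Longrightarrow> d v (2, 0) 1 = int (\<Sum>J\<in>F. \<Prod>i\<in>J. v i) mod 2"
    using H_cube_with_polynomial_coordinate[OF F, of 2 n 0] by (auto simp: F_def)
  obtain c where c: "c \<in> cubes X_nilspace n" and cd: "cube_comp n \<phi> c = d"
    using surj d unfolding cube_surjective_def by blast
  have fc: "f (c (vertex n P)) = int (card {J \<in> F. J \<subseteq> P}) mod 2" for P
  proof -
    have "f (c (vertex n P)) = d (vertex n P) (2, 0) 1"
      using vertex_in_cube_vertices[of n P] by (simp add: f_def cd[symmetric] cube_comp_def)
    also have "\<dots> = int (\<Sum>J\<in>F. of_bool (J \<subseteq> P)) mod 2"
      unfolding d_val[OF vertex_in_cube_vertices]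
      by (intro arg_cong[where f = "\<lambda>t. int t mod 2"] sum.cong refl monomial_vertex) (auto simp: F_def)
    also have "(\<Sum>J\<in>F. of_bool (J \<subseteq> P)) = card {J \<in> F. J \<subseteq> P}"
      using F by (simp add: Int_def conj_commute)
    finally show ?thesis .
  qed
  have c_carrier: "c (vertex n P) \<in> carrier X_nilspace" for P
  proof -
    have "c \<in> carrier (product_group (cube_vertices n) (\<lambda>_. X_nilspace))"
      using group.generate_in_carrier[OF _ cube_generator_carrier[OF compact_filtered_X] c[unfolded cubes_def]]
        group_X by simp
    then show ?thesis using vertex_in_cube_vertices[of n P] by (auto simp: PiE_iff)
  qed
  define \<beta> where "\<beta> i = (\<lambda>s\<in>S. c (vertex n {i}) s mod 2)" for i
  have "\<not> inj_on \<beta> {1..n}"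
  proof
    assume inj: "inj_on \<beta> {1..n}"
    have "\<beta> ` {1..n} \<subseteq> S \<rightarrow>\<^sub>E {0, 1}" by (auto simp: \<beta>_def)
    then have "card {1..n} \<le> card (S \<rightarrow>\<^sub>E {0, 1::int})"
      using S(1) by (intro card_inj_on_le[OF inj]) (auto intro: finite_PiE)
    then show False using S(1) by (simp add: card_funcsetE n_def flip: numeral_2_eq_2)
  qed
  then obtain i i' where i: "i \<in> {1..n}" "i' \<in> {1..n}" "i \<noteq> i'" "\<beta> i = \<beta> i'"
    unfolding inj_on_def by blast
  have "f (c (vertex n {i, i'})) = f (c (vertex n {}))"
  proof (rule f_mod[rule_format, OF c_carrier c_carrier])
    fix k j assume s: "(k, 1, j) \<in> S"
    then have "1 \<le> k" using S(2) by auto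
    from X_cube_affine_mod_2[OF c this i(3), of j]
    have "2 dvd c (vertex n {i, i'}) (k, 1, j) + c (vertex n {}) (k, 1, j)
        - c (vertex n {i}) (k, 1, j) - c (vertex n {i'}) (k, 1, j)" by (simp add: cong_0_iff)
    moreover have "c (vertex n {i}) (k, 1, j) mod 2 = c (vertex n {i'}) (k, 1, j) mod 2"
      using fun_cong[OF i(4), of "(k, 1, j)"] s by (simp add: \<beta>_def)
    ultimately show "[c (vertex n {i, i'}) (k, 1, j) = c (vertex n {}) (k, 1, j)] (mod 2)"
      unfolding cong_def by presburger
  qed
  moreover have "{J \<in> F. J \<subseteq> {i, i'}} = {{i, i'}}"
    using i by (auto simp: F_def card_2_iff)
  moreover have "{J \<in> F. J \<subseteq> {}} = {}"
    by (auto simp: F_def)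
  ultimately show False unfolding fc by (simp only:) simp
qed

end
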